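(* Let $\gamma\in(0,1)$ and let $|\mathrm{Ee}\rangle_{AB}=\sqrt{\gamma}|00\rangle_{AB}+\sqrt{1-\gamma}|11\rangle_{AB}$. The states in $\mathbb{C}^2\otimes\mathbb{C}^2$ that are entangled, diagonal, and orthogonal to $|\mathrm{Ee}\rangle_{AB}$ are exactly the states characterized by three complex numbers $a,b,c$ satisfying $$\frac{1}{1-\gamma}|a|^2+|b|^2+|c|^2=1,\qquad \sqrt{\gamma}\,a^2+\sqrt{1-\gamma}\,bc\neq 0,\qquad \sqrt{\gamma}\,ac^*-\sqrt{1-\gamma}\,a^*b=0,$$ through the Schmidt decomposition $$|\mathrm{eE}\rangle_{AB}=\zeta_0\left(\frac{1}{\zeta_0}\begin{bmatrix}a\\c\end{bmatrix}\right)\otimes|0\rangle+\zeta_1\left(\frac{1}{\zeta_1}\begin{bmatrix}b\\-\frac{\sqrt{\gamma}}{\sqrt{1-\gamma}}a\end{bmatrix}\right)\otimes|1\rangle,$$ where the Schmidt coefficients are $\zeta_0=\sqrt{|a|^2+|c|^2}$ and $\zeta_1=\sqrt{|b|^2+\frac{\gamma}{1-\gamma}|a|^2}$.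
   Context: $|0\rangle,|1\rangle$ is the standard basis of $\mathbb{C}^2$, $|jk\rangle_{AB}=|j\rangle_A\otimes|k\rangle_B$, column vectors are with respect to the standard basis, and $^*$ is complex conjugation. A state is a unit vector; a state in $\mathbb{C}^2\otimes\mathbb{C}^2$ is a product state if it equals $|u\rangle\otimes|v\rangle$, and entangled otherwise. A state $\sum_{j,k}c_{jk}|jk\rangle_{AB}$ is called diagonal if $c_{00}^*c_{01}+c_{10}^*c_{11}=0$. A Schmidt decomposition of a state is an expression $\sum_j\lambda_j|u_j\rangle\otimes|v_j\rangle$ with $\lambda_j\ge 0$ (the Schmidt coefficients) and $\{|u_j\rangle\}$, $\{|v_j\rangle\}$ orthonormal families in $\mathbb{C}^2$. *)

theory Defs
  imports "HOL-Analysis.Analysis"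
begin

text \<open>
  The space \<open>\<complex>\<^sup>2\<close> is \<^typ>\<open>complex ^ 2\<close> and \<open>\<complex>\<^sup>2 \<otimes> \<complex>\<^sup>2\<close> is \<^typ>\<open>complex ^ (2 \<times> 2)\<close>, so that
  \<open>\<psi> $ (j, k)\<close> is the coefficient of \<open>|jk\<rangle>\<close> (see \<open>ket_expansion\<close> below). The two elements
  of the index type \<^typ>\<open>2\<close> are \<open>0\<close> and \<open>1\<close>; the library functions that index from \<open>1\<close>
  to \<open>2\<close>, such as \<^const>\<open>vector\<close>, would place the first entry at index \<open>1\<close> and the second
  at \<open>2 = 0\<close>, and are therefore not used.
\<close>

definition ket :: "2 \<Rightarrow> complex ^ 2" where
  "ket j = axis j 1"

definition col2 :: "complex \<Rightarrow> complex \<Rightarrow> complex ^ 2" where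
  "col2 x y = x *s ket 0 + y *s ket 1"

definition tensor :: "complex ^ 'm \<Rightarrow> complex ^ 'n \<Rightarrow> complex ^ ('m \<times> 'n)" (infixr "\<otimes>" 75) where
  "u \<otimes> v = (\<chi> p. u $ fst p * v $ snd p)"

lemma ket_expansion:
  fixes \<psi> :: "complex ^ (2 \<times> 2)"
  shows "\<psi> = (\<Sum>j\<in>UNIV. \<Sum>k\<in>UNIV. \<psi> $ (j, k) *s (ket j \<otimes> ket k))"
proof -
  have cases: "j = 0 \<or> j = 1" for j :: 2
    using exhaust_2[of j] by auto
  then have UNIV_01: "(UNIV :: 2 set) = {0, 1}"
    by auto
  have "\<psi> $ (j, k) = (\<Sum>j\<in>UNIV. \<Sum>k\<in>UNIV. \<psi> $ (j, k) *s (ket j \<otimes> ket k)) $ (j, k)" for j k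
    using cases[of j] cases[of k]
    by (auto simp: UNIV_01 ket_def tensor_def axis_def)
  then show ?thesis
    unfolding vec_eq_iff split_paired_All by blast
qed

text \<open>
  The library's inner product on \<^typ>\<open>complex ^ 'n\<close> is real-valued (the real part of the
  Hermitian one), so the Hermitian inner product is defined here. The library norm is the
  Hermitian norm.
\<close>

definition cinner :: "complex ^ 'n \<Rightarrow> complex ^ 'n \<Rightarrow> complex" where
  "cinner u v = (\<Sum>i\<in>UNIV. cnj (u $ i) * v $ i)"

lemma cinner_self: "cinner u u = complex_of_real ((norm u)\<^sup>2)"
proof -
  have "(norm u)\<^sup>2 = (\<Sum>i\<in>UNIV. (cmod (u $ i))\<^sup>2)"
    by (simp add: norm_vec_def L2_set_def sum_nonneg)
  moreover have "cnj z * z = complex_of_real ((cmod z)\<^sup>2)" for z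
    using complex_norm_square[of z] by (simp only: mult.commute)
  ultimately show ?thesis
    by (simp add: cinner_def)
qed

definition is_state :: "complex ^ 'n \<Rightarrow> bool" where
  "is_state \<psi> \<longleftrightarrow> norm \<psi> = 1"

definition product_state :: "complex ^ (2 \<times> 2) \<Rightarrow> bool" where
  "product_state \<psi> \<longleftrightarrow> is_state \<psi> \<and> (\<exists>u v :: complex ^ 2. \<psi> = u \<otimes> v)"

definition entangled :: "complex ^ (2 \<times> 2) \<Rightarrow> bool" where
  "entangled \<psi> \<longleftrightarrow> is_state \<psi> \<and> \<not> product_state \<psi>"

definition diagonal :: "complex ^ (2 \<times> 2) \<Rightarrow> bool" where
  "diagonal \<psi> \<longleftrightarrow> is_state \<psi> \<and> cnj (\<psi> $ (0, 0)) * \<psi> $ (0, 1) + cnj (\<psi> $ (1, 0)) * \<psi> $ (1, 1) = 0"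

definition orthonormal_family :: "'j set \<Rightarrow> ('j \<Rightarrow> complex ^ 'n) \<Rightarrow> bool" where
  "orthonormal_family J u \<longleftrightarrow> (\<forall>i\<in>J. \<forall>j\<in>J. cinner (u i) (u j) = (if i = j then 1 else 0))"

definition schmidt_decomposition ::
  "'j set \<Rightarrow> ('j \<Rightarrow> real) \<Rightarrow> ('j \<Rightarrow> complex ^ 2) \<Rightarrow> ('j \<Rightarrow> complex ^ 2) \<Rightarrow> complex ^ (2 \<times> 2) \<Rightarrow> bool" where
  "schmidt_decomposition J l u v \<psi> \<longleftrightarrow>
     finite J \<and> (\<forall>j\<in>J. l j \<ge> 0) \<and> orthonormal_family J u \<and> orthonormal_family J v \<and>
     \<psi> = (\<Sum>j\<in>J. complex_of_real (l j) *s (u j \<otimes> v j))"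

definition Ee :: "real \<Rightarrow> complex ^ (2 \<times> 2)" where
  "Ee \<gamma> = complex_of_real (sqrt \<gamma>) *s (ket 0 \<otimes> ket 0)
         + complex_of_real (sqrt (1 - \<gamma>)) *s (ket 1 \<otimes> ket 1)"

definition eE_params :: "real \<Rightarrow> complex \<Rightarrow> complex \<Rightarrow> complex \<Rightarrow> bool" where
  "eE_params \<gamma> a b c \<longleftrightarrow>
     1 / (1 - \<gamma>) * (cmod a)\<^sup>2 + (cmod b)\<^sup>2 + (cmod c)\<^sup>2 = 1 \<and>
     complex_of_real (sqrt \<gamma>) * a\<^sup>2 + complex_of_real (sqrt (1 - \<gamma>)) * b * c \<noteq> 0 \<and>
     complex_of_real (sqrt \<gamma>) * a * cnj c - complex_of_real (sqrt (1 - \<gamma>)) * cnj a * b = 0"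

definition zeta :: "real \<Rightarrow> complex \<Rightarrow> complex \<Rightarrow> complex \<Rightarrow> 2 \<Rightarrow> real" where
  "zeta \<gamma> a b c j =
     (if j = 0 then sqrt ((cmod a)\<^sup>2 + (cmod c)\<^sup>2)
      else sqrt ((cmod b)\<^sup>2 + \<gamma> / (1 - \<gamma>) * (cmod a)\<^sup>2))"

definition eE_left :: "real \<Rightarrow> complex \<Rightarrow> complex \<Rightarrow> complex \<Rightarrow> 2 \<Rightarrow> complex ^ 2" where
  "eE_left \<gamma> a b c j =
     complex_of_real (1 / zeta \<gamma> a b c j) *s
       (if j = 0 then col2 a c
        else col2 b (- complex_of_real (sqrt \<gamma> / sqrt (1 - \<gamma>)) * a))"

definition eE :: "real \<Rightarrow> complex \<Rightarrow> complex \<Rightarrow> complex \<Rightarrow> complex ^ (2 \<times> 2)" where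
  "eE \<gamma> a b c =
     complex_of_real (zeta \<gamma> a b c 0) *s (eE_left \<gamma> a b c 0 \<otimes> ket 0)
   + complex_of_real (zeta \<gamma> a b c 1) *s (eE_left \<gamma> a b c 1 \<otimes> ket 1)"

end

theory Submission imports Defs
begin

text \<open>
  A two-qubit vector is a product vector iff its coefficient determinant
  \<open>c\<^sub>0\<^sub>0 c\<^sub>1\<^sub>1 - c\<^sub>0\<^sub>1 c\<^sub>1\<^sub>0\<close> vanishes, and orthogonality to \<open>|Ee\<rangle>\<close> is the linear equation
  \<open>c\<^sub>1\<^sub>1 = - (\<surd>\<gamma> / \<surd>(1 - \<gamma>)) c\<^sub>0\<^sub>0\<close>. With \<open>a = c\<^sub>0\<^sub>0\<close>, \<open>b = c\<^sub>0\<^sub>1\<close>, \<open>c = c\<^sub>1\<^sub>0\<close> the three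
  conditions on the parameters are then normalisation, nonvanishing of the determinant
  and diagonality. Diagonality is orthogonality of the two columns of the coefficient
  matrix, and the nonzero determinant makes both columns nonzero, so that normalising
  them gives the Schmidt decomposition.
\<close>

lemma UNIV_2_01: "(UNIV :: 2 set) = {0, 1}"
proof -
  have "j = 0 \<or> j = 1" for j :: 2
    using exhaust_2[of j] by auto
  then show ?thesis
    by auto
qed

lemma sum_2_01: "(\<Sum>j\<in>(UNIV :: 2 set). f j) = f 0 + f 1"
  by (simp add: UNIV_2_01)

lemma forall_2_01: "(\<forall>j :: 2. P j) \<longleftrightarrow> P 0 \<and> P 1"
  using UNIV_2_01 by (metis UNIV_I insertE singletonD)

lemma sum_qubit_pair:
  "(\<Sum>p\<in>(UNIV :: (2 \<times> 2) set). f p) = f (0, 0) + f (0, 1) + f (1, 0) + f (1, 1)"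
proof -
  have "sum f (UNIV :: (2 \<times> 2) set) = (\<Sum>j\<in>UNIV. \<Sum>k\<in>UNIV. f (j, k))"
    by (simp add: sum.cartesian_product)
  then show ?thesis
    by (simp add: sum_2_01 add.assoc)
qed

lemma qubit_pair_eq_iff:
  fixes \<psi> \<phi> :: "complex ^ (2 \<times> 2)"
  shows "\<psi> = \<phi> \<longleftrightarrow> \<psi> $ (0, 0) = \<phi> $ (0, 0) \<and> \<psi> $ (0, 1) = \<phi> $ (0, 1) \<and>
    \<psi> $ (1, 0) = \<phi> $ (1, 0) \<and> \<psi> $ (1, 1) = \<phi> $ (1, 1)"
  by (auto simp: vec_eq_iff split_paired_All forall_2_01)

lemma ket_nth [simp]:
  "ket 0 $ 0 = 1" "ket 0 $ 1 = 0" "ket 1 $ 0 = 0" "ket 1 $ 1 = 1"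
  by (simp_all add: ket_def axis_def)

lemma col2_nth [simp]: "col2 x y $ 0 = x" "col2 x y $ 1 = y"
  by (simp_all add: col2_def)

lemma tensor_nth [simp]: "(u \<otimes> v) $ (j, k) = u $ j * v $ k"
  by (simp add: tensor_def)

lemma is_state_qubit_pair_iff:
  "is_state (\<psi> :: complex ^ (2 \<times> 2)) \<longleftrightarrow>
    (cmod (\<psi> $ (0, 0)))\<^sup>2 + (cmod (\<psi> $ (0, 1)))\<^sup>2 + (cmod (\<psi> $ (1, 0)))\<^sup>2 + (cmod (\<psi> $ (1, 1)))\<^sup>2 = 1"
  by (simp add: is_state_def norm_vec_def L2_set_def sum_qubit_pair)

text \<open>Read as a 2x2 matrix, \<open>u \<otimes> v\<close> is the outer product of
  \<open>u\<close> and \<open>v\<close>, so the claim is that rank at most one means zero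
  determinant.\<close>

lemma tensor_iff_det_zero:
  fixes \<psi> :: "complex ^ (2 \<times> 2)"
  shows "(\<exists>u v. \<psi> = u \<otimes> v) \<longleftrightarrow> \<psi> $ (0, 0) * \<psi> $ (1, 1) = \<psi> $ (0, 1) * \<psi> $ (1, 0)"
proof
  assume "\<exists>u v. \<psi> = u \<otimes> v"
  then show "\<psi> $ (0, 0) * \<psi> $ (1, 1) = \<psi> $ (0, 1) * \<psi> $ (1, 0)"
    by auto
next
  assume det: "\<psi> $ (0, 0) * \<psi> $ (1, 1) = \<psi> $ (0, 1) * \<psi> $ (1, 0)"
  \<comment> \<open>If the first row of the matrix is nonzero, it serves as \<open>v\<close>, and
    the second entry of \<open>u\<close> is the ratio of the second row to the first, read off at a
    nonzero entry. If the first row is zero, the second row serves as \<open>v\<close>.\<close>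
  consider "\<psi> $ (0, 0) \<noteq> 0" | "\<psi> $ (0, 1) \<noteq> 0" | "\<psi> $ (0, 0) = 0" "\<psi> $ (0, 1) = 0"
    by blast
  then show "\<exists>u v. \<psi> = u \<otimes> v"
  proof cases
    case 1
    then have "\<psi> = col2 1 (\<psi> $ (1, 0) / \<psi> $ (0, 0)) \<otimes> col2 (\<psi> $ (0, 0)) (\<psi> $ (0, 1))"
      using det by (simp add: qubit_pair_eq_iff field_simps)
    then show ?thesis
      by blast
  next
    case 2
    then have "\<psi> = col2 1 (\<psi> $ (1, 1) / \<psi> $ (0, 1)) \<otimes> col2 (\<psi> $ (0, 0)) (\<psi> $ (0, 1))"
      using det by (simp add: qubit_pair_eq_iff field_simps)
    then show ?thesis
      by blast
  next
    case 3
    then have "\<psi> = col2 0 1 \<otimes> col2 (\<psi> $ (1, 0)) (\<psi> $ (1, 1))"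
      by (simp add: qubit_pair_eq_iff)
    then show ?thesis
      by blast
  qed
qed

lemma entangled_iff:
  "entangled \<psi> \<longleftrightarrow> is_state \<psi> \<and> \<psi> $ (0, 0) * \<psi> $ (1, 1) \<noteq> \<psi> $ (0, 1) * \<psi> $ (1, 0)"
  by (auto simp: entangled_def product_state_def tensor_iff_det_zero)

lemma cinner_Ee:
  "cinner (Ee \<gamma>) \<psi> = complex_of_real (sqrt \<gamma>) * \<psi> $ (0, 0) + complex_of_real (sqrt (1 - \<gamma>)) * \<psi> $ (1, 1)"
  by (simp add: cinner_def sum_qubit_pair Ee_def)

lemma zeta_sq:
  assumes "0 < \<gamma>" "\<gamma> < 1"
  shows "(zeta \<gamma> a b c 0)\<^sup>2 = (cmod a)\<^sup>2 + (cmod c)\<^sup>2"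
    and "(zeta \<gamma> a b c 1)\<^sup>2 = (cmod b)\<^sup>2 + \<gamma> / (1 - \<gamma>) * (cmod a)\<^sup>2"
  using assms by (simp_all add: zeta_def)

lemma zeta_nonneg: "0 < \<gamma> \<Longrightarrow> \<gamma> < 1 \<Longrightarrow> 0 \<le> zeta \<gamma> a b c j"
  by (simp add: zeta_def)

lemma zeta_eq_0_iff:
  assumes "0 < \<gamma>" "\<gamma> < 1"
  shows "zeta \<gamma> a b c 0 = 0 \<longleftrightarrow> a = 0 \<and> c = 0"
    and "zeta \<gamma> a b c 1 = 0 \<longleftrightarrow> b = 0 \<and> a = 0"
  using assms by (simp_all add: zeta_def add_nonneg_eq_0_iff)

text \<open>
  This also holds when some \<open>\<zeta>\<^sub>j\<close> is zero (where \<open>1 / \<zeta>\<^sub>j = 0\<close>), because the column it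
  normalises is then zero.
\<close>
lemma eE_nth:
  assumes "0 < \<gamma>" "\<gamma> < 1"
  shows "eE \<gamma> a b c $ (0, 0) = a" "eE \<gamma> a b c $ (0, 1) = b" "eE \<gamma> a b c $ (1, 0) = c"
    "eE \<gamma> a b c $ (1, 1) = - complex_of_real (sqrt \<gamma> / sqrt (1 - \<gamma>)) * a"
  using zeta_eq_0_iff[OF assms, of a b c] by (auto simp: eE_def eE_left_def)

text \<open>The equivalence holds condition by condition. Entry \<open>(1, 1)\<close> of
  \<open>eE\<close> carries the quotient of the two square roots; clearing its denominator only
  multiplies the determinant and the column inner product by a nonzero factor.\<close>

lemma eE_params_iff:
  assumes "0 < \<gamma>" "\<gamma> < 1"
  shows "eE_params \<gamma> a b c \<longleftrightarrow> entangled (eE \<gamma> a b c) \<and> diagonal (eE \<gamma> a b c)"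
proof -
  define s where "s = sqrt \<gamma>"
  define t where "t = sqrt (1 - \<gamma>)"
  have t: "t \<noteq> 0" and st: "s\<^sup>2 = \<gamma>" "t\<^sup>2 = 1 - \<gamma>" "0 \<le> s" "0 \<le> t"
    using assms by (simp_all add: s_def t_def)
  \<comment> \<open>Entries \<open>(0, 0)\<close> and \<open>(1, 1)\<close> together contribute
    \<open>1 + \<gamma> / (1 - \<gamma>) = 1 / (1 - \<gamma>)\<close> times the squared modulus of
    \<open>a\<close>.\<close>
  have "1 / (1 - \<gamma>) * (cmod a)\<^sup>2 + (cmod b)\<^sup>2 + (cmod c)\<^sup>2
      = (cmod a)\<^sup>2 + (cmod b)\<^sup>2 + (cmod c)\<^sup>2 + (cmod (- complex_of_real (s / t) * a))\<^sup>2"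
    using assms st by (simp add: norm_mult norm_divide power_mult_distrib power_divide) (simp add: field_simps)
  then have "1 / (1 - \<gamma>) * (cmod a)\<^sup>2 + (cmod b)\<^sup>2 + (cmod c)\<^sup>2 = 1 \<longleftrightarrow> is_state (eE \<gamma> a b c)"
    by (simp only: is_state_qubit_pair_iff eE_nth[OF assms] s_def t_def)
  moreover have "complex_of_real s * a\<^sup>2 + complex_of_real t * b * c
      = - complex_of_real t * (a * (- complex_of_real (s / t) * a) - b * c)"
    using t by (simp add: field_simps power2_eq_square)
  then have "complex_of_real s * a\<^sup>2 + complex_of_real t * b * c \<noteq> 0
      \<longleftrightarrow> a * (- complex_of_real (s / t) * a) \<noteq> b * c"
    using t by simp
  moreover have "complex_of_real s * a * cnj c - complex_of_real t * cnj a * b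
      = - complex_of_real t * (cnj a * b + cnj c * (- complex_of_real (s / t) * a))"
    using t by (simp add: field_simps)
  then have "complex_of_real s * a * cnj c - complex_of_real t * cnj a * b = 0
      \<longleftrightarrow> cnj a * b + cnj c * (- complex_of_real (s / t) * a) = 0"
    using t by simp
  ultimately show ?thesis
    by (auto simp: eE_params_def entangled_iff diagonal_def eE_nth[OF assms] s_def t_def)
qed

text \<open>Orthogonality fixes the last entry in terms of the first and leaves the other three
  free, so these three are the parameters.\<close>

lemma cinner_Ee_eq_0_iff:
  assumes "0 < \<gamma>" "\<gamma> < 1"
  shows "cinner (Ee \<gamma>) \<psi> = 0 \<longleftrightarrow> \<psi> = eE \<gamma> (\<psi> $ (0, 0)) (\<psi> $ (0, 1)) (\<psi> $ (1, 0))"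
proof -
  have t: "sqrt (1 - \<gamma>) \<noteq> 0"
    using assms by simp
  \<comment> \<open>The double minus is kept so that the vanishing of the second factor is literally
    the equation with entry \<open>(1, 1)\<close> of \<open>eE\<close>.\<close>
  have "cinner (Ee \<gamma>) \<psi> = complex_of_real (sqrt (1 - \<gamma>)) *
      (\<psi> $ (1, 1) - - complex_of_real (sqrt \<gamma> / sqrt (1 - \<gamma>)) * \<psi> $ (0, 0))"
    using t by (simp add: cinner_Ee field_simps)
  then have "cinner (Ee \<gamma>) \<psi> = 0 \<longleftrightarrow>
      \<psi> $ (1, 1) = - complex_of_real (sqrt \<gamma> / sqrt (1 - \<gamma>)) * \<psi> $ (0, 0)"
    using t by (simp only: mult_eq_0_iff of_real_eq_0_iff right_minus_eq simp_thms)
  then show ?thesis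
    by (simp only: qubit_pair_eq_iff[of \<psi>] eE_nth[OF assms] simp_thms)
qed

lemma orthonormal_family_ket: "orthonormal_family UNIV ket"
  by (auto simp: orthonormal_family_def forall_2_01 cinner_def sum_2_01)

lemma orthonormal_family_eE_left:
  assumes \<gamma>: "0 < \<gamma>" "\<gamma> < 1" and params: "eE_params \<gamma> a b c"
  shows "orthonormal_family UNIV (eE_left \<gamma> a b c)"
proof -
  define r where "r = sqrt \<gamma> / sqrt (1 - \<gamma>)"
  define z where "z = zeta \<gamma> a b c"
  have left: "eE_left \<gamma> a b c 0 $ 0 = a / z 0" "eE_left \<gamma> a b c 0 $ 1 = c / z 0"
    "eE_left \<gamma> a b c 1 $ 0 = b / z 1" "eE_left \<gamma> a b c 1 $ 1 = - (r * a / z 1)"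
    by (simp_all add: eE_left_def z_def r_def)
  \<comment> \<open>\<open>a = c = 0\<close> or \<open>a = b = 0\<close> would contradict the second
    condition of \<open>eE_params\<close>.\<close>
  have "z 0 \<noteq> 0" "z 1 \<noteq> 0"
    using params zeta_eq_0_iff[OF \<gamma>, of a b c] by (auto simp: z_def eE_params_def)
  \<comment> \<open>This fact and the next give the diagonal Gram entries: each \<open>z j\<close>
    is the norm of its column.\<close>
  moreover have "cnj a * a + cnj c * c = complex_of_real ((z 0)\<^sup>2)"
    unfolding z_def zeta_sq[OF \<gamma>] of_real_add complex_norm_square by (simp add: mult.commute)
  moreover have "cnj b * b + r\<^sup>2 * (cnj a * a) = complex_of_real ((z 1)\<^sup>2)"
    using \<gamma> unfolding z_def zeta_sq[OF \<gamma>] of_real_add of_real_mult complex_norm_square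
    by (simp add: r_def power_divide mult.commute flip: of_real_power)
  moreover have diag: "cnj a * b - cnj c * (r * a) = 0"
    using params by (simp add: eE_params_iff[OF \<gamma>] diagonal_def eE_nth[OF \<gamma>] r_def)
  \<comment> \<open>The conjugate equation is the Gram entry with the two vectors in the opposite
    order.\<close>
  moreover have "a * cnj b - c * (r * cnj a) = 0"
    using arg_cong[OF diag, of cnj] by simp
  ultimately show ?thesis
    by (simp add: orthonormal_family_def forall_2_01 cinner_def sum_2_01 left
        divide_simps power2_eq_square algebra_simps)
qed

lemma schmidt_decomposition_eE:
  assumes "0 < \<gamma>" "\<gamma> < 1" "eE_params \<gamma> a b c"
  shows "schmidt_decomposition UNIV (zeta \<gamma> a b c) (eE_left \<gamma> a b c) ket (eE \<gamma> a b c)"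
  using assms orthonormal_family_eE_left orthonormal_family_ket
  by (simp add: schmidt_decomposition_def zeta_nonneg eE_def sum_2_01)

theorem proposition7:
  fixes \<gamma> :: real
  assumes "0 < \<gamma>" and "\<gamma> < 1"
  shows "{\<psi>. entangled \<psi> \<and> diagonal \<psi> \<and> cinner (Ee \<gamma>) \<psi> = 0} =
           {eE \<gamma> a b c | a b c. eE_params \<gamma> a b c} \<and>
         (\<forall>a b c. eE_params \<gamma> a b c \<longrightarrow>
           schmidt_decomposition UNIV (zeta \<gamma> a b c) (eE_left \<gamma> a b c) ket (eE \<gamma> a b c))"
proof -
  have "entangled \<psi> \<and> diagonal \<psi> \<and> cinner (Ee \<gamma>) \<psi> = 0 \<longleftrightarrow>
      (\<exists>a b c. \<psi> = eE \<gamma> a b c \<and> eE_params \<gamma> a b c)" for \<psi>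
    \<comment> \<open>The witnesses \<open>a\<close>, \<open>b\<close>, \<open>c\<close> are the
      first three entries of \<open>\<psi>\<close>; conversely, \<open>eE_nth\<close> recovers them
      from \<open>eE\<close>, which gives orthogonality.\<close>
    by (metis assms cinner_Ee_eq_0_iff eE_nth(1,2,3) eE_params_iff)
  then show ?thesis
    using assms schmidt_decomposition_eE by blast
qed

end
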